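(* Let $k\ge2$ and let $\alpha$ be an irrational real number with a $k$-automatic continued fraction expansion $[a_0,a_1,a_2,\ldots]$. Let $p_n/q_n$ be the $n$-th convergent of $\alpha$. Let $\beta=\liminf_{n\to\infty}p_n/p_{n-1}$, $\gamma=\liminf_{n\to\infty}q_n/q_{n-1}$, $\delta=\limsup_{n\to\infty}p_n/p_{n-1}$ and $\zeta=\limsup_{n\to\infty}q_n/q_{n-1}$. Then the continued fraction expansion of each of $\beta,\gamma,\delta,\zeta$ is $k$-automatic.
   Context: A continued fraction expansion $[a_0,a_1,\ldots]$ is called $k$-automatic if its partial quotients are bounded and the sequence $(a_i)_{i\ge0}$ is $k$-automatic, i.e., there is a deterministic finite automaton with output $M=(Q,\{0,\ldots,k-1\},\Delta,\delta',q_0,\tau)$ with $a_n=\tau(\delta'(q_0,w^R))$ for every base-$k$ representation $w$ of $n$ (leading zeros allowed), $w^R$ the reversal of $w$. The convergents are $p_n/q_n=[a_0,a_1,\ldots,a_n]$ with $p_n,q_n$ given by the standard recurrences $p_n=a_np_{n-1}+p_{n-2}$, $q_n=a_nq_{n-1}+q_{n-2}$, $p_{-1}=1,q_{-1}=0,p_{-2}=0,q_{-2}=1$. *)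

theory Defs
  imports Complex_Main "HOL-Library.Extended_Real"
begin

definition is_dfao ::
  "'q set \<Rightarrow> nat \<Rightarrow> 'b set \<Rightarrow> ('q \<Rightarrow> nat \<Rightarrow> 'q) \<Rightarrow> 'q \<Rightarrow> ('q \<Rightarrow> 'b) \<Rightarrow> bool" where
  "is_dfao Q k \<Delta> \<delta> q0 \<tau> \<longleftrightarrow>
     finite Q \<and> finite \<Delta> \<and> q0 \<in> Q \<and> (\<forall>q\<in>Q. \<forall>d<k. \<delta> q d \<in> Q) \<and> (\<forall>q\<in>Q. \<tau> q \<in> \<Delta>)"

text \<open>Words are written with the most significant digit first, while \<^const>\<open>horner_sum\<close> expects the
  least significant digit first. Leading zeros are allowed; the empty word represents 0.\<close>

definition is_base_repr :: "nat \<Rightarrow> nat list \<Rightarrow> nat \<Rightarrow> bool" where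
  "is_base_repr k w n \<longleftrightarrow> set w \<subseteq> {..<k} \<and> horner_sum id k (rev w) = n"

text \<open>The state set is a finite subset of \<^typ>\<open>nat\<close>; up to renaming of states this is no restriction.\<close>

definition automatic_seq :: "nat \<Rightarrow> (nat \<Rightarrow> 'b) \<Rightarrow> bool" where
  "automatic_seq k a \<longleftrightarrow>
     (\<exists>(Q :: nat set) \<Delta> \<delta> q0 \<tau>. is_dfao Q k \<Delta> \<delta> q0 \<tau> \<and>
        (\<forall>n w. is_base_repr k w n \<longrightarrow> a n = \<tau> (foldl \<delta> q0 (rev w))))"

text \<open>The first two equations of each recurrence are the general one with
  \<open>p\<^sub>-\<^sub>1 = 1\<close>, \<open>p\<^sub>-\<^sub>2 = 0\<close>, \<open>q\<^sub>-\<^sub>1 = 0\<close>, \<open>q\<^sub>-\<^sub>2 = 1\<close> substituted.\<close>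

fun conv_p :: "(nat \<Rightarrow> int) \<Rightarrow> nat \<Rightarrow> int" where
  "conv_p a 0 = a 0"
| "conv_p a (Suc 0) = a 1 * a 0 + 1"
| "conv_p a (Suc (Suc n)) = a (Suc (Suc n)) * conv_p a (Suc n) + conv_p a n"

fun conv_q :: "(nat \<Rightarrow> int) \<Rightarrow> nat \<Rightarrow> int" where
  "conv_q a 0 = 1"
| "conv_q a (Suc 0) = a 1"
| "conv_q a (Suc (Suc n)) = a (Suc (Suc n)) * conv_q a (Suc n) + conv_q a n"

text \<open>\<open>x = [a\<^sub>0, a\<^sub>1, a\<^sub>2, \<dots>]\<close> as an infinite simple continued fraction; \<open>a\<^sub>0\<close> is an arbitrary integer.\<close>

definition cf_expansion :: "(nat \<Rightarrow> int) \<Rightarrow> real \<Rightarrow> bool" where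
  "cf_expansion a x \<longleftrightarrow>
     (\<forall>i\<ge>1. a i \<ge> 1) \<and> (\<lambda>n. real_of_int (conv_p a n) / real_of_int (conv_q a n)) \<longlonglongrightarrow> x"

definition automatic_cf :: "nat \<Rightarrow> (nat \<Rightarrow> int) \<Rightarrow> bool" where
  "automatic_cf k a \<longleftrightarrow> (\<exists>B. \<forall>i. \<bar>a i\<bar> \<le> B) \<and> automatic_seq k a"

text \<open>The infinite continued fraction expansion of a real number is unique if it exists, so the
  existential quantifier speaks about \<^emph>\<open>the\<close> expansion of \<open>x\<close>.\<close>

definition has_automatic_cf :: "nat \<Rightarrow> real \<Rightarrow> bool" where
  "has_automatic_cf k x \<longleftrightarrow> (\<exists>b. cf_expansion b x \<and> automatic_cf k b)"

end

theory Submission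
  imports Defs
begin

text \<open>We have \<open>q\<^sub>n/q\<^sub>n\<^sub>-\<^sub>1 = [a\<^sub>n, \<dots>, a\<^sub>1]\<close>, and \<open>p\<^sub>n/p\<^sub>n\<^sub>-\<^sub>1\<close> differs from it by
  \<open>\<plusminus>1/(p\<^sub>n\<^sub>-\<^sub>1 q\<^sub>n\<^sub>-\<^sub>1) \<longlongrightarrow> 0\<close>, so \<open>\<beta> = \<gamma>\<close> and \<open>\<delta> = \<zeta>\<close>. With bounded partial quotients
  the map from words to continued fractions is uniformly contracting, so the limit inferior is
  \<open>[b\<^sub>0, b\<^sub>1, \<dots>]\<close>, where \<open>b\<close> is the least infinite word, in the alternating lexicographic order, all
  of whose prefixes occur reversed infinitely often in \<open>a\<close>; the limit superior is the same for the
  opposite order. The relation \<open>b\<^sub>n = c\<close> is first-order definable from addition and \<open>a\<close>. Functions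
  of several natural numbers with finite \<open>k\<close>-kernel are closed under first-order operations, and a
  sequence is \<open>k\<close>-automatic iff its \<open>k\<close>-kernel is finite.\<close>

section \<open>Finite kernels\<close>

text \<open>An environment assigns values to countably many variables; each kernel step prepends a digit to
  every variable simultaneously.\<close>

definition finite_kernel :: "nat \<Rightarrow> ((nat \<Rightarrow> nat) \<Rightarrow> 'b) \<Rightarrow> bool" where
  "finite_kernel k f \<longleftrightarrow> (\<exists>K. finite K \<and> f \<in> K \<and>
     (\<forall>g\<in>K. \<forall>r. (\<forall>i. r i < k) \<longrightarrow> (\<lambda>v. g (\<lambda>i. k * v i + r i)) \<in> K))"

lemma finite_kernelI:
  assumes "finite K" "f \<in> K"
    and "\<And>g r. g \<in> K \<Longrightarrow> (\<And>i. r i < k) \<Longrightarrow> (\<lambda>v. g (\<lambda>i. k * v i + r i)) \<in> K"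
  shows "finite_kernel k f"
  unfolding finite_kernel_def by (intro exI[of _ K] conjI ballI allI impI assms) blast+

section \<open>Closure of finite kernels under first-order operations\<close>

lemma finite_kernel_const: "finite_kernel k (\<lambda>v. c)"
  by (rule finite_kernelI[of "{\<lambda>v. c}"]) auto

text \<open>Product construction: a digit step acts on both arguments at once. The value types are
  arbitrary, so connectives, comparisons and integer arithmetic are all instances.\<close>

lemma finite_kernel_comp2:
  assumes "finite_kernel k f" "finite_kernel k g"
  shows "finite_kernel k (\<lambda>v. h (f v) (g v))"
proof -
  obtain K where K: "finite K" "f \<in> K"
    "\<And>g r. g \<in> K \<Longrightarrow> (\<And>i. r i < k) \<Longrightarrow> (\<lambda>v. g (\<lambda>i. k * v i + r i)) \<in> K"
    using assms(1) unfolding finite_kernel_def by blast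
  obtain L where L: "finite L" "g \<in> L"
    "\<And>g r. g \<in> L \<Longrightarrow> (\<And>i. r i < k) \<Longrightarrow> (\<lambda>v. g (\<lambda>i. k * v i + r i)) \<in> L"
    using assms(2) unfolding finite_kernel_def by blast
  let ?c = "\<lambda>(p, q) v. h (p v) (q v)"
  show ?thesis
  proof (rule finite_kernelI[of "?c ` (K \<times> L)"])
    show "finite (?c ` (K \<times> L))" using K(1) L(1) by simp
    show "(\<lambda>v. h (f v) (g v)) \<in> ?c ` (K \<times> L)"
      by (rule image_eqI[of _ _ "(f, g)"]) (use K L in auto)
  next
    fix u and r :: "nat \<Rightarrow> nat"
    assume u: "u \<in> ?c ` (K \<times> L)" and r: "\<And>i. r i < k"
    then obtain p q where pq: "p \<in> K" "q \<in> L" "u = (\<lambda>v. h (p v) (q v))" by auto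
    show "(\<lambda>v. u (\<lambda>i. k * v i + r i)) \<in> ?c ` (K \<times> L)"
      by (rule image_eqI[of _ _ "(\<lambda>v. p (\<lambda>i. k * v i + r i), \<lambda>v. q (\<lambda>i. k * v i + r i))"])
        (use pq K(3)[OF pq(1) r] L(3)[OF pq(2) r] in auto)
  qed
qed

lemmas finite_kernel_conj = finite_kernel_comp2[where h = "(\<and>)"]
lemmas finite_kernel_disj = finite_kernel_comp2[where h = "(\<or>)"]
lemmas finite_kernel_imp = finite_kernel_comp2[where h = "(\<longrightarrow>)"]
lemmas finite_kernel_eq_int = finite_kernel_comp2[where h = "(=) :: int \<Rightarrow> int \<Rightarrow> bool"]
lemmas finite_kernel_less_int = finite_kernel_comp2[where h = "(<) :: int \<Rightarrow> int \<Rightarrow> bool"]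
lemmas finite_kernel_times_int = finite_kernel_comp2[where h = "(*) :: int \<Rightarrow> int \<Rightarrow> int"]

lemma finite_kernel_not:
  assumes "finite_kernel k P"
  shows "finite_kernel k (\<lambda>v. \<not> P v)"
  by (rule finite_kernel_comp2[OF assms assms, where h = "\<lambda>x y. \<not> x"])

lemma finite_kernel_if:
  assumes "finite_kernel k P" "finite_kernel k f" "finite_kernel k g"
  shows "finite_kernel k (\<lambda>v. if P v then f v else g v)"
proof -
  have "finite_kernel k (\<lambda>v. (f v, g v))"
    by (rule finite_kernel_comp2[OF assms(2,3), where h = Pair])
  from finite_kernel_comp2[OF assms(1) this, where h = "\<lambda>b (x, y). if b then x else y"]
  show ?thesis by simp
qed

text \<open>Variables are de Bruijn indices: the bound variable becomes index 0. The kernel of the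
  projection consists of unions of projections of kernel elements, because the last digit of the
  witness can be guessed.\<close>

lemma finite_kernel_ex:
  assumes k: "k > 0" and fin: "finite_kernel k (\<lambda>v. P (\<lambda>i. v (Suc i)) (v 0))"
  shows "finite_kernel k (\<lambda>v. \<exists>y. P v y)"
proof -
  let ?Q = "\<lambda>v. P (\<lambda>i. v (Suc i)) (v 0)"
  obtain K where K: "finite K" "?Q \<in> K"
    "\<And>g r. g \<in> K \<Longrightarrow> (\<And>i. r i < k) \<Longrightarrow> (\<lambda>v. g (\<lambda>i. k * v i + r i)) \<in> K"
    using fin unfolding finite_kernel_def by blast
  let ?e = "\<lambda>S v. \<exists>g\<in>S. \<exists>y. g (case_nat y v)"
  show ?thesis
  proof (rule finite_kernelI[of "?e ` Pow K"])
    show "finite (?e ` Pow K)" using K(1) by simp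
    show "(\<lambda>v. \<exists>y. P v y) \<in> ?e ` Pow K"
      by (rule image_eqI[of _ _ "{?Q}"]) (use K(2) in auto)
  next
    fix u and r :: "nat \<Rightarrow> nat"
    assume u: "u \<in> ?e ` Pow K" and r: "\<And>i. r i < k"
    then obtain S where S: "S \<subseteq> K" "u = ?e S" by auto
    \<comment> \<open>\<open>?t g s\<close> feeds digit \<open>s\<close> to the bound variable and
      the digits \<open>r\<close> to the free variables, whose indices are shifted by one.\<close>
    let ?t = "\<lambda>g s v. g (\<lambda>i. k * v i + case_nat s r i)"
    let ?S = "{?t g s | g s. g \<in> S \<and> s < k}"
    have upd: "case_nat (k * z + s) (\<lambda>i. k * v i + r i)
       = (\<lambda>i. k * case_nat z v i + case_nat s r i)" for z s v
      by (auto split: nat.splits)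
    have "?S \<subseteq> K"
    proof
      fix x assume "x \<in> ?S"
      then obtain g s where x: "x = ?t g s" and gs: "g \<in> S" "s < k" by blast
      have "case_nat s r i < k" for i using gs(2) r by (cases i) auto
      then show "x \<in> K" unfolding x by (rule K(3)[OF subsetD[OF S(1) gs(1)]])
    qed
    moreover have "(\<lambda>v. u (\<lambda>i. k * v i + r i)) = ?e ?S"
    proof (rule ext)
      fix v
      show "u (\<lambda>i. k * v i + r i) = ?e ?S v"
    proof
      assume "u (\<lambda>i. k * v i + r i)"
      then obtain g y where g: "g \<in> S" "g (case_nat y (\<lambda>i. k * v i + r i))"
        unfolding S(2) by blast
      \<comment> \<open>The last digit of the witness selects the kernel element; the quotient is
        the new witness.\<close>
      have "g (case_nat (k * (y div k) + y mod k) (\<lambda>i. k * v i + r i))" using g(2) by simp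
      then have "?t g (y mod k) (case_nat (y div k) v)" unfolding upd .
      moreover have "?t g (y mod k) \<in> ?S"
        by (rule CollectI, rule exI[of _ g], rule exI[of _ "y mod k"]) (use g(1) k in simp)
      ultimately show "?e ?S v" by (intro bexI[of _ "?t g (y mod k)"] exI[of _ "y div k"])
    next
      assume "?e ?S v"
      then obtain h y where "h \<in> ?S" and h: "h (case_nat y v)" by (elim bexE exE)
      then obtain g s where g: "h = ?t g s" "g \<in> S" by blast
      have "g (case_nat (k * y + s) (\<lambda>i. k * v i + r i))" unfolding upd using h g(1) by simp
      then show "u (\<lambda>i. k * v i + r i)" unfolding S(2) using g(2) by blast
    qed
    qed
    ultimately show "(\<lambda>v. u (\<lambda>i. k * v i + r i)) \<in> ?e ` Pow K"
      by (intro image_eqI[OF _ PowI])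
  qed
qed

lemma finite_kernel_all:
  assumes "k > 0" "finite_kernel k (\<lambda>v. P (\<lambda>i. v (Suc i)) (v 0))"
  shows "finite_kernel k (\<lambda>v. \<forall>y. P v y)"
proof -
  have "finite_kernel k (\<lambda>v. \<exists>y. \<not> P v y)"
    by (rule finite_kernel_ex[OF assms(1)], rule finite_kernel_not[OF assms(2)])
  from finite_kernel_not[OF this] show ?thesis by simp
qed

section \<open>Addition, order and parity\<close>

lemma add_base_eq_iff:
  fixes x y z k r s t c :: nat
  assumes "r < k" "s < k" "t < k" "c \<le> 1"
  shows "k * x + r + (k * y + s) + c = k * z + t \<longleftrightarrow>
    (r + s + c) mod k = t \<and> x + y + (r + s + c) div k = z"
proof -
  have "k * x + r + (k * y + s) + c = k * (x + y + (r + s + c) div k) + (r + s + c) mod k"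
    by (simp add: algebra_simps)
  moreover have "k * p + q = k * z + t \<longleftrightarrow> q = t \<and> p = z" if "q < k" for p q
  proof
    assume *: "k * p + q = k * z + t"
    have "(k * p + q) mod k = q" "(k * p + q) div k = p" using that by simp_all
    moreover have "(k * z + t) mod k = t" "(k * z + t) div k = z" using assms(3) by simp_all
    ultimately show "q = t \<and> p = z" using * by simp
  qed simp
  ultimately show ?thesis using assms by simp
qed

text \<open>The kernel elements record the carry of schoolbook addition.\<close>

lemma finite_kernel_add: "finite_kernel k (\<lambda>v. v i + v j = v l)"
proof -
  let ?A = "\<lambda>c v. v i + v j + c = (v l :: nat)"
  show ?thesis
  proof (rule finite_kernelI[of "{?A 0, ?A 1, \<lambda>v. False}"])
    fix g and r :: "nat \<Rightarrow> nat"
    assume g: "g \<in> {?A 0, ?A 1, \<lambda>v. False}" and r: "\<And>i. r i < k"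
    show "(\<lambda>v. g (\<lambda>i. k * v i + r i)) \<in> {?A 0, ?A 1, \<lambda>v. False}"
    proof (cases "g = (\<lambda>v. False)")
      case False
      then obtain c where c: "c \<le> 1" "g = ?A c" using g by fastforce
      have "r i + r j + c < 2 * k" using r[of i] r[of j] c by linarith
      then have d: "(r i + r j + c) div k \<in> {0, 1}"
        using less_mult_imp_div_less[of _ 2 k] by fastforce
      show ?thesis
      proof (cases "(r i + r j + c) mod k = r l")
        case True
        then have "(\<lambda>v. g (\<lambda>i. k * v i + r i)) = ?A ((r i + r j + c) div k)"
          unfolding c(2) by (subst add_base_eq_iff) (use r c in auto)
        then show ?thesis using d by auto
      next
        case False
        then have "(\<lambda>v. g (\<lambda>i. k * v i + r i)) = (\<lambda>v. False)"
          unfolding c(2) by (subst add_base_eq_iff) (use r c in auto)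
        then show ?thesis by simp
      qed
    qed simp
  qed auto
qed

lemma finite_kernel_le:
  assumes "k > 0"
  shows "finite_kernel k (\<lambda>v. v i \<le> v j)"
proof -
  have "finite_kernel k (\<lambda>v. \<exists>d. v i + d = v j)"
    by (intro finite_kernel_ex finite_kernel_add assms)
  then show ?thesis by (simp add: le_iff_add eq_commute)
qed

lemma finite_kernel_less:
  assumes "k > 0"
  shows "finite_kernel k (\<lambda>v. v i < v j)"
  using finite_kernel_not[OF finite_kernel_le[OF assms, of j i]] by (simp add: not_le)

lemma finite_kernel_even:
  assumes "k > 0"
  shows "finite_kernel k (\<lambda>v. even (v i))"
proof -
  have "finite_kernel k (\<lambda>v. \<exists>d. d + d = v i)"
    by (intro finite_kernel_ex finite_kernel_add assms)
  moreover have "(\<exists>d. d + d = n) \<longleftrightarrow> even n" for n :: nat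
    by (metis dvd_def mult_2)
  ultimately show ?thesis by simp
qed

text \<open>A function with finitely many values is a nested case distinction over its level sets.
  This reduces automaticity of an integer sequence to definability of the relations
  \<open>f v = c\<close>.\<close>

lemma finite_kernel_of_level_sets:
  fixes f :: "(nat \<Rightarrow> nat) \<Rightarrow> int"
  assumes "finite (range f)" "\<And>c. finite_kernel k (\<lambda>v. f v = c)"
  shows "finite_kernel k f"
proof -
  \<comment> \<open>The default 0 outside \<open>D\<close> is never reached once \<open>D\<close> is
    the whole range of \<open>f\<close>.\<close>
  have "finite_kernel k (\<lambda>v. if f v \<in> D then f v else 0)" if "finite D" for D
    using that
  proof (induction D)
    case empty
    then show ?case by (simp add: finite_kernel_const)
  next
    case (insert c D)
    have "finite_kernel k (\<lambda>v. if f v = c then c else if f v \<in> D then f v else 0)"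
      by (intro finite_kernel_if[OF assms(2) finite_kernel_const] insert.IH)
    moreover have "(\<lambda>v. if f v = c then c else if f v \<in> D then f v else 0)
      = (\<lambda>v. if f v \<in> insert c D then f v else 0)" by auto
    ultimately show ?case by simp
  qed
  from this[OF assms(1)] show ?thesis by simp
qed

section \<open>Passing between automata and finite kernels\<close>

lemma horner_sum_append:
  "horner_sum id k (xs @ ys) = horner_sum id k xs + (k :: nat) ^ length xs * horner_sum id k ys"
  by (induction xs) (auto simp: algebra_simps)

lemma base_digits_exist:
  assumes "k \<ge> 2"
  shows "\<exists>w. set w \<subseteq> {..<k} \<and> horner_sum id k w = (n :: nat)"
proof (induction n rule: less_induct)
  case (less n)
  show ?case
  proof (cases "n = 0")
    case True
    then show ?thesis by (intro exI[of _ "[]"]) simp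
  next
    case False
    then have "n div k < n" using assms by simp
    then obtain w where "set w \<subseteq> {..<k}" "horner_sum id k w = n div k" using less by blast
    then show ?thesis using assms by (intro exI[of _ "n mod k # w"]) (auto simp: id_def)
  qed
qed

text \<open>The automaton reads the least significant digit first, so fixing the low digits
  \<open>w\<close> amounts to starting in the state reached on \<open>w\<close>. Hence each kernel
  element is determined by a state.\<close>

lemma finite_kernel_of_automatic_seq:
  assumes k: "k \<ge> 2" and aut: "automatic_seq k a"
  shows "finite_kernel k (\<lambda>v. a (v i))"
proof -
  obtain Q :: "nat set" and \<Delta> \<delta> q0 \<tau> where M: "is_dfao Q k \<Delta> \<delta> q0 \<tau>"
    and a: "\<And>n w. is_base_repr k w n \<Longrightarrow> a n = \<tau> (foldl \<delta> q0 (rev w))"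
    using aut unfolding automatic_seq_def by blast
  have a': "a (horner_sum id k w) = \<tau> (foldl \<delta> q0 w)" if "set w \<subseteq> {..<k}" for w
    using a[of "rev w" "horner_sum id k w"] that by (simp add: is_base_repr_def)
  obtain dg where dg: "\<And>n. set (dg n) \<subseteq> {..<k}" "\<And>n. horner_sum id k (dg n) = n"
    using base_digits_exist[OF k] by metis
  let ?f = "\<lambda>w v. a (horner_sum id k w + k ^ length w * v i)"
  let ?K = "{?f w | w. set w \<subseteq> {..<k}}"
  show ?thesis
  proof (rule finite_kernelI[of ?K])
    have "?K \<subseteq> (\<lambda>q v. \<tau> (foldl \<delta> q (dg (v i)))) ` Q"
    proof
      fix x assume "x \<in> ?K"
      then obtain w where w: "x = ?f w" "set w \<subseteq> {..<k}" by blast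
      have mem: "foldl \<delta> q w \<in> Q" if "q \<in> Q" for q
        using w(2) that
      proof (induction w arbitrary: q)
        case (Cons d w)
        then show ?case using M by (auto simp: is_dfao_def)
      qed simp
      have "?f w v = \<tau> (foldl \<delta> (foldl \<delta> q0 w) (dg (v i)))" for v
        using a'[of "w @ dg (v i)"] w(2) dg by (simp add: horner_sum_append)
      moreover have "foldl \<delta> q0 w \<in> Q" using mem M by (simp add: is_dfao_def)
      ultimately show "x \<in> (\<lambda>q v. \<tau> (foldl \<delta> q (dg (v i)))) ` Q"
        unfolding w(1) by (intro image_eqI[of _ _ "foldl \<delta> q0 w"]) auto
    qed
    moreover have "finite Q" using M by (simp add: is_dfao_def)
    ultimately show "finite ?K" by (meson finite_imageI finite_subset)
    show "(\<lambda>v. a (v i)) \<in> ?K" by (rule CollectI, rule exI[of _ "[]"]) simp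
  next
    fix g and r :: "nat \<Rightarrow> nat"
    assume g: "g \<in> ?K" and r: "\<And>i. r i < k"
    then obtain w where w: "g = ?f w" "set w \<subseteq> {..<k}" by blast
    have "(\<lambda>v. g (\<lambda>i. k * v i + r i)) = ?f (w @ [r i])"
      unfolding w(1) by (simp add: horner_sum_append algebra_simps)
    moreover have "set (w @ [r i]) \<subseteq> {..<k}" using w r by simp
    ultimately show "(\<lambda>v. g (\<lambda>i. k * v i + r i)) \<in> ?K" by blast
  qed
qed

text \<open>The states are the kernel elements, coded by \<open>e\<close> as natural numbers. Each
  digit is fed to all variables at once; the output is the value at the zero environment, which is
  what remains after all digits are read.\<close>

lemma automatic_seq_of_finite_kernel:
  assumes "finite_kernel k (\<lambda>v. b (v 0))"
  shows "automatic_seq k b"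
proof -
  obtain K where K: "finite K" "(\<lambda>v :: nat \<Rightarrow> nat. b (v 0)) \<in> K"
    "\<And>g r. g \<in> K \<Longrightarrow> (\<And>i. r i < k) \<Longrightarrow> (\<lambda>v. g (\<lambda>i. k * v i + r i)) \<in> K"
    using assms unfolding finite_kernel_def by blast
  obtain e :: "((nat \<Rightarrow> nat) \<Rightarrow> 'a) \<Rightarrow> nat" where e: "inj_on e K"
    using finite_imp_inj_to_nat_seg[OF K(1)] by blast
  let ?i = "inv_into K e"
  let ?s = "\<lambda>g d v. g (\<lambda>i. k * v i + d)"
  define \<delta> where "\<delta> = (\<lambda>q d. e (?s (?i q) d))"
  define \<tau> where "\<tau> = (\<lambda>q. ?i q (\<lambda>_. 0))"
  have s: "?s g d \<in> K" if "g \<in> K" "d < k" for g d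
    using K(3)[OF that(1), of "\<lambda>_. d"] that(2) by simp
  have run: "\<tau> (foldl \<delta> (e g) w) = g (\<lambda>_. horner_sum id k w)"
    if "g \<in> K" "set w \<subseteq> {..<k}" for g w
    using that
  proof (induction w arbitrary: g)
    case Nil
    then show ?case using e by (simp add: \<tau>_def)
  next
    case (Cons d w)
    have "\<delta> (e g) d = e (?s g d)" using Cons.prems e by (simp add: \<delta>_def)
    then show ?case using Cons.IH[OF s[OF Cons.prems(1), of d]] Cons.prems
      by (simp add: add.commute)
  qed
  have "is_dfao (e ` K) k (\<tau> ` (e ` K)) \<delta> (e (\<lambda>v. b (v 0))) \<tau>"
    unfolding is_dfao_def using K s e by (auto simp: \<delta>_def)
  moreover have "b n = \<tau> (foldl \<delta> (e (\<lambda>v. b (v 0))) (rev w))" if "is_base_repr k w n" for n w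
    using run[OF K(2), of "rev w"] that by (simp add: is_base_repr_def)
  ultimately show ?thesis unfolding automatic_seq_def by blast
qed

lemma finite_kernel_at_diff:
  fixes a :: "nat \<Rightarrow> int"
  assumes "k \<ge> 2" "automatic_seq k a" "finite (range a)"
  shows "finite_kernel k (\<lambda>v. a (v i - v j))"
proof (rule finite_kernel_of_level_sets)
  show "finite (range (\<lambda>v. a (v i - v j)))"
    by (rule finite_subset[OF _ assms(3)]) auto
  fix c
  \<comment> \<open>Subtraction is truncated: below zero the index is 0, which
    \<open>x + x = x\<close> defines by addition alone.\<close>
  have "finite_kernel k (\<lambda>v. \<exists>x. (x + v j = v i \<or> v i < v j \<and> x + x = x) \<and> a x = c)"
    by (intro finite_kernel_ex finite_kernel_conj finite_kernel_disj finite_kernel_less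
        finite_kernel_add finite_kernel_eq_int finite_kernel_const
        finite_kernel_of_automatic_seq[OF assms(1,2)]) (use assms(1) in auto)
  moreover have "(\<exists>x. (x + v j = v i \<or> v i < v j \<and> x + x = x) \<and> a x = c) \<longleftrightarrow> a (v i - v j) = c"
    for v :: "nat \<Rightarrow> nat"
  proof (cases "v i < v j")
    case True
    then have "(x + v j = v i \<or> v i < v j \<and> x + x = x) \<longleftrightarrow> x = v i - v j" for x by auto
    then show ?thesis by simp
  next
    case False
    then have "(x + v j = v i \<or> v i < v j \<and> x + x = x) \<longleftrightarrow> x = v i - v j" for x by auto
    then show ?thesis by simp
  qed
  ultimately show "finite_kernel k (\<lambda>v. a (v i - v j) = c)" by simp
qed

section \<open>The alternating-least recurrent reversed word\<close>

text \<open>A continued fraction is increasing in its partial quotients of even index and decreasing in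
  those of odd index. Comparing the keys of the first differing partial quotients therefore orders
  continued fractions by value for \<open>\<sigma> = 1\<close> and by negated value for \<open>\<sigma> = -1\<close>.\<close>

definition alt_key :: "int \<Rightarrow> nat \<Rightarrow> int \<Rightarrow> int" where
  "alt_key \<sigma> t x = (if even t then \<sigma> * x else - \<sigma> * x)"

definition rev_match :: "(nat \<Rightarrow> int) \<Rightarrow> nat \<Rightarrow> (nat \<Rightarrow> int) \<Rightarrow> nat \<Rightarrow> bool" where
  "rev_match a i b n \<longleftrightarrow> (\<forall>s<n. a (i - s) = b s)"

text \<open>\<open>b\<close> is the limit inferior, in the order above, of the words \<open>a\<^sub>i a\<^sub>i\<^sub>-\<^sub>1 \<dots> a\<^sub>0\<close>.\<close>

definition alt_least_rev :: "int \<Rightarrow> (nat \<Rightarrow> int) \<Rightarrow> (nat \<Rightarrow> int) \<Rightarrow> bool" where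
  "alt_least_rev \<sigma> a b \<longleftrightarrow>
     (\<forall>n. \<exists>\<^sub>\<infinity>i. rev_match a i b n) \<and>
     (\<forall>t. \<forall>\<^sub>\<infinity>i. rev_match a i b t \<longrightarrow> \<not> alt_key \<sigma> t (a (i - t)) < alt_key \<sigma> t (b t))"

text \<open>Greedy choice on a shrinking infinite set of positions: among the letters that
  infinitely many surviving positions have at distance \<open>n\<close>, take one of least key. The
  pigeonhole principle provides one, and letters of smaller key occur only finitely often.\<close>

lemma alt_least_rev_exists:
  assumes fin: "finite (range a)"
  shows "\<exists>b. alt_least_rev \<sigma> a b"
proof -
  define best where "best n I c \<longleftrightarrow> infinite {i \<in> I. a (i - n) = c} \<and>
    finite {i \<in> I. alt_key \<sigma> n (a (i - n)) < alt_key \<sigma> n c}" for n I c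
  have ex_best: "\<exists>c. best n I c" if I: "infinite I" for n and I :: "nat set"
  proof -
    let ?C = "{c \<in> range a. infinite {i \<in> I. a (i - n) = c}}"
    have "finite ?C" using fin by simp
    moreover have "?C \<noteq> {}"
    proof
      assume e: "?C = {}"
      have "finite (\<Union>c\<in>range a. {i \<in> I. a (i - n) = c})"
        using e by (intro finite_UN_I fin) blast
      moreover have "(\<Union>c\<in>range a. {i \<in> I. a (i - n) = c}) = I" by auto
      ultimately show False using I by simp
    qed
    ultimately obtain c where c: "c \<in> ?C" "\<And>d. d \<in> ?C \<Longrightarrow> alt_key \<sigma> n c \<le> alt_key \<sigma> n d"
      using arg_min_if_finite[of ?C "alt_key \<sigma> n"] not_less by blast
    have "{i \<in> I. alt_key \<sigma> n (a (i - n)) < alt_key \<sigma> n c}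
      = (\<Union>d\<in>{d \<in> range a. alt_key \<sigma> n d < alt_key \<sigma> n c}. {i \<in> I. a (i - n) = d})" by auto
    moreover have "finite {i \<in> I. a (i - n) = d}"
      if "d \<in> range a" "alt_key \<sigma> n d < alt_key \<sigma> n c" for d
    proof (rule ccontr)
      assume "infinite {i \<in> I. a (i - n) = d}"
      then have "alt_key \<sigma> n c \<le> alt_key \<sigma> n d" using that(1) by (intro c(2)) simp
      then show False using that(2) by simp
    qed
    ultimately have "finite {i \<in> I. alt_key \<sigma> n (a (i - n)) < alt_key \<sigma> n c}"
      using fin by auto
    then show ?thesis using c(1) unfolding best_def by blast
  qed
  \<comment> \<open>The conjunct for \<open>n = 0\<close> pins the start, so that \<open>I n\<close>
    becomes exactly the set of positions matching \<open>b\<close> on \<open>n\<close>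
    letters.\<close>
  have "\<exists>I. \<forall>n. (infinite (I n) \<and> (n = 0 \<longrightarrow> I n = UNIV)) \<and>
      (\<exists>c. best n (I n) c \<and> I (Suc n) = {i \<in> I n. a (i - n) = c})"
  proof (rule dependent_nat_choice)
    show "\<exists>I::nat set. infinite I \<and> (0 = (0::nat) \<longrightarrow> I = UNIV)" by (auto simp: infinite_UNIV_nat)
    fix I :: "nat set" and n :: nat
    assume "infinite I \<and> (n = 0 \<longrightarrow> I = UNIV)"
    then obtain c where "best n I c" using ex_best by blast
    then show "\<exists>J. (infinite J \<and> (Suc n = 0 \<longrightarrow> J = UNIV)) \<and>
        (\<exists>c. best n I c \<and> J = {i \<in> I. a (i - n) = c})"
      by (intro exI[of _ "{i \<in> I. a (i - n) = c}"] conjI exI[of _ c]) (auto simp: best_def)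
  qed
  then obtain I where I': "\<And>n. infinite (I n)" and I0: "I 0 = UNIV"
    and "\<forall>n. \<exists>c. best n (I n) c \<and> I (Suc n) = {i \<in> I n. a (i - n) = c}"
    by blast
  from choice[OF this(3)] obtain b where b: "\<And>n. best n (I n) (b n)"
    "\<And>n. I (Suc n) = {i \<in> I n. a (i - n) = b n}"
    by blast
  have mem: "I n = {i. rev_match a i b n}" for n
    by (induction n) (auto simp: I0 b(2) rev_match_def less_Suc_eq)
  show ?thesis
    unfolding alt_least_rev_def
  proof (intro exI[of _ b] conjI allI)
    show "\<exists>\<^sub>\<infinity>i. rev_match a i b n" for n
      using I'[of n] by (simp add: mem INFM_iff_infinite)
    show "\<forall>\<^sub>\<infinity>i. rev_match a i b t \<longrightarrow> \<not> alt_key \<sigma> t (a (i - t)) < alt_key \<sigma> t (b t)" for t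
      using b(1)[of t] by (simp add: best_def mem MOST_iff_cofinite)
  qed
qed

lemma alt_key_inj: "\<sigma> \<noteq> 0 \<Longrightarrow> alt_key \<sigma> t x = alt_key \<sigma> t y \<longleftrightarrow> x = y"
  by (auto simp: alt_key_def)

text \<open>Compares the words read backwards from \<open>j\<close> and \<open>i\<close> on their
  first \<open>n + 1\<close> letters. It is spelled out without \<open>rev_match\<close> and
  \<open>alt_key\<close> so that the closure rules for finite kernels apply directly to its
  formula.\<close>

definition alt_rev_less :: "int \<Rightarrow> (nat \<Rightarrow> int) \<Rightarrow> nat \<Rightarrow> nat \<Rightarrow> nat \<Rightarrow> bool" where
  "alt_rev_less \<sigma> a j i n \<longleftrightarrow> (\<exists>t. t \<le> n \<and> (\<forall>s. s < t \<longrightarrow> a (j - s) = a (i - s)) \<and>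
     (if even t then \<sigma> * a (j - t) < \<sigma> * a (i - t) else \<sigma> * a (i - t) < \<sigma> * a (j - t)))"

lemma alt_rev_less_iff:
  "alt_rev_less \<sigma> a j i n \<longleftrightarrow>
     (\<exists>t\<le>n. rev_match a j (\<lambda>s. a (i - s)) t \<and> alt_key \<sigma> t (a (j - t)) < alt_key \<sigma> t (a (i - t)))"
  unfolding alt_rev_less_def rev_match_def alt_key_def by (auto split: if_splits)

lemma rev_match_mismatchE:
  assumes "\<not> rev_match a i b (Suc n)"
  obtains t where "t \<le> n" "rev_match a i b t" "a (i - t) \<noteq> b t"
proof -
  let ?P = "\<lambda>t. t \<le> n \<and> a (i - t) \<noteq> b t"
  have "\<exists>t. ?P t" using assms by (auto simp: rev_match_def less_Suc_eq_le)
  then have "?P (LEAST t. ?P t)" by (rule LeastI_ex)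
  moreover have "rev_match a i b (LEAST t. ?P t)"
    unfolding rev_match_def using not_less_Least[of _ ?P] calculation by fastforce
  ultimately show thesis using that by blast
qed

text \<open>The right-hand side is a first-order formula over addition, order and the letters of \<open>a\<close>;
  this is what makes \<open>b\<close> automatic.\<close>

lemma alt_least_rev_eq_iff:
  assumes b: "alt_least_rev \<sigma> a b" and \<sigma>: "\<sigma> \<noteq> 0"
  shows "b n = c \<longleftrightarrow> (\<exists>N0. \<forall>N. N0 \<le> N \<longrightarrow>
    (\<exists>i. N \<le> i \<and> (\<forall>j. N \<le> j \<longrightarrow> \<not> alt_rev_less \<sigma> a j i n) \<and> a (i - n) = c))"
proof -
  \<comment> \<open>Only finitely many \<open>t\<close> matter, so one threshold \<open>M\<close>
    serves them all.\<close>
  have "\<forall>\<^sub>\<infinity>i. \<forall>t\<in>{..n}. rev_match a i b t \<longrightarrow> \<not> alt_key \<sigma> t (a (i - t)) < alt_key \<sigma> t (b t)"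
    using b unfolding alt_least_rev_def by (intro eventually_ball_finite) auto
  then obtain M where M: "\<And>i t. \<lbrakk>M \<le> i; t \<le> n; rev_match a i b t\<rbrakk> \<Longrightarrow>
      \<not> alt_key \<sigma> t (a (i - t)) < alt_key \<sigma> t (b t)"
    unfolding MOST_nat_le by auto
  have ex: "\<exists>i\<ge>N. rev_match a i b (Suc n)" for N
    using b unfolding alt_least_rev_def INFM_nat_le by blast
  \<comment> \<open>Beyond \<open>M\<close>, the positions whose word of length \<open>n + 1\<close>
    is least are exactly those that show the prefix of \<open>b\<close>.\<close>
  have least: "(\<forall>j. N \<le> j \<longrightarrow> \<not> alt_rev_less \<sigma> a j i n) \<longleftrightarrow> rev_match a i b (Suc n)"
    if N: "M \<le> N" "N \<le> i" for N i
  proof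
    assume m: "rev_match a i b (Suc n)"
    show "\<forall>j. N \<le> j \<longrightarrow> \<not> alt_rev_less \<sigma> a j i n"
    proof (intro allI impI notI)
      fix j assume j: "N \<le> j" "alt_rev_less \<sigma> a j i n"
      then obtain t where t: "t \<le> n" "rev_match a j (\<lambda>s. a (i - s)) t"
        "alt_key \<sigma> t (a (j - t)) < alt_key \<sigma> t (a (i - t))" unfolding alt_rev_less_iff by blast
      have "rev_match a j b t" "a (i - t) = b t" using t(1,2) m by (auto simp: rev_match_def)
      then show False using M[of j t] t(1,3) j(1) N by simp
    qed
  next
    assume l: "\<forall>j. N \<le> j \<longrightarrow> \<not> alt_rev_less \<sigma> a j i n"
    show "rev_match a i b (Suc n)"
    proof (rule ccontr)
      assume "\<not> rev_match a i b (Suc n)"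
      then obtain t where t: "t \<le> n" "rev_match a i b t" "a (i - t) \<noteq> b t"
        by (rule rev_match_mismatchE)
      have less: "alt_key \<sigma> t (b t) < alt_key \<sigma> t (a (i - t))"
        using M[of i t] t N alt_key_inj[OF \<sigma>, of t "a (i - t)" "b t"] by force
      \<comment> \<open>A later occurrence of the prefix of \<open>b\<close> beats the word at
        \<open>i\<close>.\<close>
      obtain j where j: "j \<ge> N" "rev_match a j b (Suc n)" using ex by blast
      have "alt_rev_less \<sigma> a j i n"
        unfolding alt_rev_less_iff using t(1,2) less j(2)
        by (intro exI[of _ t]) (auto simp: rev_match_def)
      then show False using l j(1) by blast
    qed
  qed
  show ?thesis
  proof
    assume c: "b n = c"
    show "\<exists>N0. \<forall>N. N0 \<le> N \<longrightarrow>
      (\<exists>i. N \<le> i \<and> (\<forall>j. N \<le> j \<longrightarrow> \<not> alt_rev_less \<sigma> a j i n) \<and> a (i - n) = c)"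
    proof (rule exI[of _ M], intro allI impI)
      fix N assume N: "M \<le> N"
      obtain i where i: "i \<ge> N" "rev_match a i b (Suc n)" using ex by blast
      then show "\<exists>i. N \<le> i \<and> (\<forall>j. N \<le> j \<longrightarrow> \<not> alt_rev_less \<sigma> a j i n) \<and> a (i - n) = c"
        using least[OF N i(1)] c by (intro exI[of _ i]) (auto simp: rev_match_def)
    qed
  next
    assume "\<exists>N0. \<forall>N. N0 \<le> N \<longrightarrow>
      (\<exists>i. N \<le> i \<and> (\<forall>j. N \<le> j \<longrightarrow> \<not> alt_rev_less \<sigma> a j i n) \<and> a (i - n) = c)"
    then obtain N0 where "\<And>N. N0 \<le> N \<Longrightarrow>
      (\<exists>i. N \<le> i \<and> (\<forall>j. N \<le> j \<longrightarrow> \<not> alt_rev_less \<sigma> a j i n) \<and> a (i - n) = c)" by blast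
    from this[of "max N0 M"] obtain i where i: "max N0 M \<le> i"
      "\<forall>j. max N0 M \<le> j \<longrightarrow> \<not> alt_rev_less \<sigma> a j i n" "a (i - n) = c" by auto
    then have "rev_match a i b (Suc n)" using least[of "max N0 M" i] by simp
    then show "b n = c" using i(3) by (simp add: rev_match_def)
  qed
qed

text \<open>Arbitrary \<open>N\<close> lets bounds valid only from index 1 on pass from
  \<open>a\<close> to \<open>b\<close>; \<open>a 0\<close> itself may be nonpositive.\<close>

lemma alt_least_rev_mem:
  assumes "alt_least_rev \<sigma> a b"
  shows "\<exists>m\<ge>N. b n = a m"
proof -
  obtain i where "i \<ge> N + n" "rev_match a i b (Suc n)"
    using assms unfolding alt_least_rev_def INFM_nat_le by blast
  then show ?thesis by (intro exI[of _ "i - n"]) (auto simp: rev_match_def)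
qed

lemma automatic_seq_alt_least_rev:
  assumes k: "k \<ge> 2" and a: "automatic_seq k a" "finite (range a)"
    and b: "alt_least_rev \<sigma> a b" and \<sigma>: "\<sigma> \<noteq> 0"
  shows "automatic_seq k b"
proof (rule automatic_seq_of_finite_kernel, rule finite_kernel_of_level_sets)
  show "finite (range (\<lambda>v. b (v 0)))"
    by (rule finite_subset[OF _ a(2)]) (use alt_least_rev_mem[OF b] in blast)
  fix c
  have k0: "k > 0" using k by simp
  show "finite_kernel k (\<lambda>v. b (v 0) = c)"
    \<comment> \<open>After unfolding, every atom compares variables, tests parity, or compares
      multiples of entries of \<open>a\<close> at differences or constants.\<close>
    unfolding alt_least_rev_eq_iff[OF b \<sigma>] alt_rev_less_def
    by (intro finite_kernel_ex[OF k0] finite_kernel_all[OF k0] finite_kernel_imp finite_kernel_conj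
        finite_kernel_not finite_kernel_if finite_kernel_eq_int finite_kernel_less_int
        finite_kernel_times_int finite_kernel_const finite_kernel_even[OF k0]
        finite_kernel_le[OF k0] finite_kernel_less[OF k0] finite_kernel_at_diff[OF k a])
qed

section \<open>Continued fractions with bounded partial quotients\<close>

text \<open>\<open>cf_tail c n z = [c\<^sub>0, \<dots>, c\<^sub>n\<^sub>-\<^sub>1, z]\<close>.\<close>

fun cf_tail :: "(nat \<Rightarrow> int) \<Rightarrow> nat \<Rightarrow> real \<Rightarrow> real" where
  "cf_tail c 0 z = z"
| "cf_tail c (Suc n) z = cf_tail c n (real_of_int (c n) + 1 / z)"

lemma cf_tail_cong: "(\<And>s. s < n \<Longrightarrow> c s = d s) \<Longrightarrow> cf_tail c n z = cf_tail d n z"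
  by (induction n arbitrary: z) auto

text \<open>Each level inverts its argument and so reverses the order; the induction swaps
  \<open>z\<close> and \<open>w\<close>.\<close>

lemma cf_tail_mono:
  assumes "\<And>s. s < n \<Longrightarrow> c s \<ge> 1" "0 < z" "z \<le> w"
  shows "if even n then cf_tail c n z \<le> cf_tail c n w else cf_tail c n w \<le> cf_tail c n z"
  using assms
proof (induction n arbitrary: z w)
  case (Suc n)
  have c: "c n \<ge> 1" using Suc.prems(1) by simp
  have "0 < real_of_int (c n) + 1 / w" using c Suc.prems(2,3) by (intro add_pos_pos) simp_all
  moreover have "real_of_int (c n) + 1 / w \<le> real_of_int (c n) + 1 / z"
    using Suc.prems by (simp add: frac_le)
  ultimately show ?case using Suc.IH[of "c n + 1 / w" "c n + 1 / z"] Suc.prems(1) by simp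
qed simp

text \<open>For partial quotients between 1 and \<open>B\<close>, an interval invariant under
  passing from \<open>z\<close> to \<open>c + 1 / z\<close>. Its lower end exceeds 1, which makes
  inversion a strict contraction; \<open>cf_rate\<close> is the reciprocal of that end.\<close>

definition cf_range :: "real \<Rightarrow> real set" where
  "cf_range B = {1 + 1 / (B + 1) .. B + 1}"

definition cf_rate :: "real \<Rightarrow> real" where
  "cf_rate B = 1 / (1 + 1 / (B + 1))"

lemma cf_rate_bounds: "B \<ge> 1 \<Longrightarrow> 0 < cf_rate B" "B \<ge> 1 \<Longrightarrow> cf_rate B < 1"
  by (auto simp: cf_rate_def field_simps)

text \<open>The argument need only be at least 1, so that a final entry 1 enters the range after one
  step.\<close>

lemma cf_step_in_range:
  fixes c :: int and B z :: real
  assumes "1 \<le> c" "c \<le> B" "1 \<le> z" "z \<le> B + 1"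
  shows "c + 1 / z \<in> cf_range B"
proof -
  have "1 / (B + 1) \<le> 1 / z" using assms by (intro frac_le) auto
  moreover have "1 / z \<le> 1" using assms by simp
  moreover have "1 \<le> real_of_int c" using assms(1) by simp
  ultimately show ?thesis using assms(2) unfolding cf_range_def atLeastAtMost_iff by linarith
qed

lemma cf_range_ge_1: "z \<in> cf_range B \<Longrightarrow> B \<ge> 1 \<Longrightarrow> 1 \<le> z"
  unfolding cf_range_def by (auto intro: order_trans[of _ "1 + 1 / (B + 1)"])

lemma cf_range_top:
  assumes "B \<ge> 1"
  shows "B + 1 \<in> cf_range B"
proof -
  have "1 / (B + 1) \<le> 1" using assms by simp
  then show ?thesis using assms unfolding cf_range_def atLeastAtMost_iff by linarith
qed

lemma cf_range_le: "z \<in> cf_range B \<Longrightarrow> z \<le> B + 1"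
  unfolding cf_range_def by simp

text \<open>Inversion divides distances by \<open>z * w\<close>, which is at least \<open>z\<close>
  and hence at least the lower end of the range.\<close>

lemma cf_tail_contraction:
  assumes B: "B \<ge> 1" and "\<And>s. s < n \<Longrightarrow> 1 \<le> c s \<and> c s \<le> B" "z \<in> cf_range B" "w \<in> cf_range B"
  shows "\<bar>cf_tail c n z - cf_tail c n w\<bar> \<le> cf_rate B ^ n * \<bar>z - w\<bar>"
  using assms(2-)
proof (induction n arbitrary: z w)
  case (Suc n)
  let ?z = "real_of_int (c n) + 1 / z" and ?w = "real_of_int (c n) + 1 / w"
  have ge: "1 \<le> z" "1 \<le> w" using Suc.prems cf_range_ge_1 B by auto
  have r: "1 + 1 / (B + 1) \<le> z" using Suc.prems(2) by (simp add: cf_range_def)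
  have "\<bar>?z - ?w\<bar> = \<bar>z - w\<bar> / (z * w)"
  proof -
    have "?z - ?w = (w - z) / (z * w)" using ge by (simp add: field_simps)
    then show ?thesis using ge by (simp add: abs_mult abs_minus_commute)
  qed
  also have "\<dots> \<le> \<bar>z - w\<bar> / (1 + 1 / (B + 1))"
  proof (rule divide_left_mono)
    have "z * 1 \<le> z * w" using ge by (intro mult_left_mono) auto
    then show "1 + 1 / (B + 1) \<le> z * w" using r by simp
    show "0 < z * w * (1 + 1 / (B + 1))" using ge B by (intro mult_pos_pos add_pos_pos) auto
  qed simp
  finally have "\<bar>?z - ?w\<bar> \<le> cf_rate B * \<bar>z - w\<bar>" by (simp add: cf_rate_def)
  moreover have "?z \<in> cf_range B" "?w \<in> cf_range B"
    using Suc.prems ge cf_range_le by (auto intro!: cf_step_in_range)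
  then have "\<bar>cf_tail c n ?z - cf_tail c n ?w\<bar> \<le> cf_rate B ^ n * \<bar>?z - ?w\<bar>"
    using Suc.prems by (intro Suc.IH) auto
  ultimately have "\<bar>cf_tail c n ?z - cf_tail c n ?w\<bar> \<le> cf_rate B ^ n * (cf_rate B * \<bar>z - w\<bar>)"
    using cf_rate_bounds(1)[OF B] by (meson mult_left_mono order_trans zero_le_power less_imp_le)
  then show ?case by (simp add: mult_ac)
qed simp

lemma cf_tail_close:
  assumes B: "B \<ge> 1" and "\<And>s. s < n \<Longrightarrow> 1 \<le> c s \<and> c s \<le> B" "z \<in> cf_range B" "w \<in> cf_range B"
  shows "\<bar>cf_tail c n z - cf_tail c n w\<bar> \<le> cf_rate B ^ n * B"
proof -
  have "1 / (B + 1) \<ge> 0" using B by simp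
  then have "\<bar>z - w\<bar> \<le> B" using assms(3,4) unfolding cf_range_def atLeastAtMost_iff by linarith
  then show ?thesis using cf_tail_contraction[OF assms] cf_rate_bounds(1)[OF B]
    by (meson mult_left_mono order_trans zero_le_power less_imp_le)
qed

text \<open>The inner levels from \<open>n\<close> on collapse into a single tail, which stays in
  the invariant interval.\<close>

lemma cf_tail_prefix:
  assumes B: "B \<ge> 1" and "\<And>s. s < m \<Longrightarrow> 1 \<le> c s \<and> c s \<le> B" "z \<in> cf_range B" "n \<le> m"
  shows "\<exists>w\<in>cf_range B. cf_tail c m z = cf_tail c n w"
  using assms(4,2,3)
proof (induction m arbitrary: z rule: dec_induct)
  case (step m)
  have "real_of_int (c m) + 1 / z \<in> cf_range B"
    using step.prems(1)[of m] cf_range_ge_1[OF step.prems(2) B] cf_range_le[OF step.prems(2)]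
    by (intro cf_step_in_range) simp_all
  then show ?case using step.IH[of "c m + 1 / z"] step.prems(1) by auto
qed auto

section \<open>Growth of denominators and convergence\<close>

lemma conv_q_ge_1:
  assumes "\<And>i. i \<ge> 1 \<Longrightarrow> c i \<ge> 1"
  shows "conv_q c n \<ge> 1"
  using assms
proof (induction c n rule: conv_q.induct)
  case (3 a n)
  have "1 * 1 \<le> a (Suc (Suc n)) * conv_q a (Suc n)"
    using 3(1)[OF 3(3)] 3(3)[of "Suc (Suc n)"] by (intro mult_mono) auto
  then show ?case using 3(2)[OF 3(3)] by simp
qed auto

lemma conv_q_ge:
  assumes "\<And>i. i \<ge> 1 \<Longrightarrow> c i \<ge> 1"
  shows "conv_q c n \<ge> int n"
proof (induction n rule: induct_nat_012)
  case (ge2 n)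
  have "conv_q c (Suc n) * 1 \<le> conv_q c (Suc n) * c (Suc (Suc n))"
    using assms[of "Suc (Suc n)"] conv_q_ge_1[of c "Suc n", OF assms]
    by (intro mult_left_mono) simp_all
  then have "conv_q c (Suc n) \<le> c (Suc (Suc n)) * conv_q c (Suc n)" by (simp add: mult.commute)
  then show ?case using ge2 conv_q_ge_1[of c n, OF assms]
    unfolding conv_q.simps of_nat_Suc by linarith
qed (use assms in auto)

text \<open>The classical formula with complete quotient \<open>z\<close>, linking nested fractions
  to the convergents.\<close>

lemma cf_tail_conv:
  assumes c: "\<And>i. c i \<ge> 1" and "z > 0"
  shows "cf_tail c (Suc (Suc n)) z =
    (z * conv_p c (Suc n) + conv_p c n) / (z * conv_q c (Suc n) + conv_q c n)"
  using assms(2)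
proof (induction n arbitrary: z)
  case 0
  have "real_of_int (c 1) > 0" "real_of_int (c 0) > 0" using c[of 1] c[of 0] by linarith+
  then have "real_of_int (c 1) * z + 1 > 0" using 0 by (intro add_pos_pos mult_pos_pos) auto
  then show ?case using 0 by (simp add: field_simps)
next
  case (Suc n)
  let ?w = "real_of_int (c (Suc (Suc n))) + 1 / z"
  have w: "?w > 0" using c[of "Suc (Suc n)"] Suc.prems by (intro add_pos_pos) auto
  have q: "real_of_int (conv_q c m) > 0" for m
    using conv_q_ge_1[of c m] c by (smt (verit) of_int_0_less_iff)
  have "cf_tail c (Suc (Suc (Suc n))) z =
    (?w * conv_p c (Suc n) + conv_p c n) / (?w * conv_q c (Suc n) + conv_q c n)"
    using Suc.IH[OF w] by simp
  also have "\<dots> = (z * (?w * conv_p c (Suc n) + conv_p c n)) / (z * (?w * conv_q c (Suc n) + conv_q c n))"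
    using Suc.prems by simp
  also have "z * (?w * conv_p c (Suc n) + conv_p c n) = z * conv_p c (Suc (Suc n)) + conv_p c (Suc n)"
    using Suc.prems by (simp add: field_simps)
  also have "z * (?w * conv_q c (Suc n) + conv_q c n) = z * conv_q c (Suc (Suc n)) + conv_q c (Suc n)"
    using Suc.prems by (simp add: field_simps)
  finally show ?case .
qed

lemma cf_tail_limit:
  fixes B :: real
  assumes B: "B \<ge> 1" and c: "\<And>s. 1 \<le> c s \<and> c s \<le> B"
  shows "\<exists>L. cf_expansion c L \<and>
    (\<forall>n. \<forall>z\<in>cf_range B. \<bar>cf_tail c n z - L\<bar> \<le> cf_rate B ^ n * B)"
proof -
  define x where "x n = cf_tail c n (B + 1)" for n
  note top = cf_range_top[OF B]
  have close: "\<bar>x m - cf_tail c n z\<bar> \<le> cf_rate B ^ n * B" if nm: "n \<le> m" and z: "z \<in> cf_range B" for m n z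
  proof -
    obtain w where "w \<in> cf_range B" "x m = cf_tail c n w"
      using cf_tail_prefix[of B m c "B + 1" n] B c top nm unfolding x_def by auto
    then show ?thesis using cf_tail_close[of B n c w z] B c z by simp
  qed
  have rate: "(\<lambda>n. cf_rate B ^ n * B) \<longlonglongrightarrow> 0"
    using cf_rate_bounds[OF B] by (intro tendsto_mult_left_zero LIMSEQ_power_zero) auto
  have "Cauchy x"
  proof (rule metric_CauchyI)
    fix e :: real assume "e > 0"
    then have "\<forall>\<^sub>F n in sequentially. cf_rate B ^ n * B < e / 2"
      using rate by (intro order_tendstoD(2)) auto
    then obtain N where N: "cf_rate B ^ N * B < e / 2" by (auto simp: eventually_sequentially)
    have near: "\<bar>x m - x N\<bar> < e / 2" if "m \<ge> N" for m
      using close[OF that top] N unfolding x_def by linarith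
    have "dist (x m) (x n) < e" if "m \<ge> N" "n \<ge> N" for m n
      using near[OF that(1)] near[OF that(2)] unfolding dist_real_def by linarith
    then show "\<exists>M. \<forall>m\<ge>M. \<forall>n\<ge>M. dist (x m) (x n) < e" by blast
  qed
  then obtain L where L: "x \<longlonglongrightarrow> L" using Cauchy_convergent convergent_def by blast
  have near: "\<bar>cf_tail c n z - L\<bar> \<le> cf_rate B ^ n * B" if z: "z \<in> cf_range B" for n z
  proof -
    have "(\<lambda>m. \<bar>x m - cf_tail c n z\<bar>) \<longlonglongrightarrow> \<bar>L - cf_tail c n z\<bar>" by (intro tendsto_intros L)
    then have "\<bar>L - cf_tail c n z\<bar> \<le> cf_rate B ^ n * B"
      by (rule LIMSEQ_le_const2) (intro exI[of _ n] allI impI close z)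
    then show ?thesis by (simp add: abs_minus_commute)
  qed
  have "(\<lambda>n. real_of_int (conv_p c (Suc (Suc n))) / real_of_int (conv_q c (Suc (Suc n)))) \<longlonglongrightarrow> L"
  proof (rule LIMSEQ_I)
    fix e :: real assume "e > 0"
    then have "\<forall>\<^sub>F n in sequentially. cf_rate B ^ n * B < e" using rate by (intro order_tendstoD(2)) auto
    then obtain N where N: "\<And>n. n \<ge> N \<Longrightarrow> cf_rate B ^ n * B < e" by (auto simp: eventually_sequentially)
    have "norm (real_of_int (conv_p c (Suc (Suc n))) / real_of_int (conv_q c (Suc (Suc n))) - L) < e" if "n \<ge> N" for n
    proof -
      \<comment> \<open>The last entry of a convergent may be 1, outside \<open>cf_range\<close>;
        merging it with the entry before gives a tail inside.\<close>
      let ?z = "real_of_int (c (Suc n)) + 1 / c (Suc (Suc n))"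
      have "?z \<in> cf_range B"
      proof (rule cf_step_in_range)
        show "1 \<le> real_of_int (c (Suc (Suc n)))" using c[of "Suc (Suc n)"] by simp
        show "real_of_int (c (Suc (Suc n))) \<le> B + 1" using c[of "Suc (Suc n)"] by linarith
      qed (use c[of "Suc n"] in simp_all)
      then have "\<bar>cf_tail c (Suc n) ?z - L\<bar> < e" using near[of ?z "Suc n"] N[of "Suc n"] that by linarith
      moreover have "cf_tail c (Suc n) ?z = cf_tail c (Suc (Suc n)) (c (Suc (Suc n)))" by simp
      moreover have "0 < c (Suc (Suc n))" using c[of "Suc (Suc n)"] by linarith
      then have "cf_tail c (Suc (Suc n)) (c (Suc (Suc n)))
        = real_of_int (conv_p c (Suc (Suc n))) / real_of_int (conv_q c (Suc (Suc n)))"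
        using c by (subst cf_tail_conv) simp_all
      ultimately show ?thesis by simp
    qed
    then show "\<exists>no. \<forall>n\<ge>no. norm (real_of_int (conv_p c (Suc (Suc n))) / real_of_int (conv_q c (Suc (Suc n))) - L) < e" by blast
  qed
  then have "(\<lambda>n. real_of_int (conv_p c n) / real_of_int (conv_q c n)) \<longlonglongrightarrow> L"
    using LIMSEQ_offset[of "\<lambda>n. real_of_int (conv_p c n) / real_of_int (conv_q c n)" 2] by simp
  then have "cf_expansion c L" using c by (auto simp: cf_expansion_def)
  then show ?thesis using near by (intro exI[of _ L] conjI allI ballI)
qed

section \<open>Ratios of consecutive convergents\<close>

text \<open>Distinct integers differ by at least 1 while \<open>1 / w\<close> is at most 1, so the
  first differing partial quotient decides; the parity in \<open>alt_key\<close> matches that in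
  \<open>cf_tail_mono\<close>.\<close>

lemma cf_tail_alt_less:
  fixes w u :: real
  assumes "\<And>s. s < t \<Longrightarrow> 1 \<le> b s" "1 \<le> b t" "1 \<le> d" "1 \<le> w" "1 \<le> u"
    and "\<sigma> = 1 \<or> \<sigma> = -1" "alt_key \<sigma> t (b t) < alt_key \<sigma> t d"
  shows "\<sigma> * cf_tail b t (b t + 1 / w) \<le> \<sigma> * cf_tail b t (d + 1 / u)"
proof -
  have step: "0 < real_of_int x + 1 / w \<and> real_of_int x + 1 / w \<le> real_of_int y + 1 / u"
    if "1 \<le> x" "x < y" "1 \<le> w" "1 \<le> u" for x y :: int and w u :: real
  proof -
    have "real_of_int x + 1 \<le> y" "0 < real_of_int x" using that by linarith+
    moreover have "0 < 1 / w" "1 / w \<le> 1" "0 < 1 / u" using that by simp_all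
    ultimately show ?thesis by linarith
  qed
  show ?thesis
  proof (cases "b t < d")
    case True
    then show ?thesis using cf_tail_mono[of t b "b t + 1 / w" "d + 1 / u"] step[of "b t" d w u] assms
      by (auto simp: alt_key_def split: if_splits)
  next
    case False
    then have "d < b t" using assms(6,7) by (cases "d = b t") (auto simp: alt_key_def)
    then show ?thesis using cf_tail_mono[of t b "d + 1 / u" "b t + 1 / w"] step[of d "b t" u w] assms
      by (auto simp: alt_key_def split: if_splits)
  qed
qed

lemma conv_q_ratio_Suc:
  assumes "\<And>i. i \<ge> 1 \<Longrightarrow> a i \<ge> 1"
  shows "real_of_int (conv_q a (Suc (Suc i))) / conv_q a (Suc i)
    = a (Suc (Suc i)) + 1 / (real_of_int (conv_q a (Suc i)) / conv_q a i)"
  using conv_q_ge_1[of a "Suc i", OF assms] conv_q_ge_1[of a i, OF assms]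
  by (simp add: field_simps)

text \<open>At \<open>i = 0\<close> the ratio is \<open>a 1\<close>, which may equal 1 and then lies
  outside \<open>cf_range\<close>.\<close>

lemma conv_q_ratio_bounds:
  fixes B :: real
  assumes "\<And>i. i \<ge> 1 \<Longrightarrow> a i \<ge> 1 \<and> a i \<le> B"
  shows "1 \<le> real_of_int (conv_q a (Suc i)) / conv_q a i"
    "i > 0 \<Longrightarrow> real_of_int (conv_q a (Suc i)) / conv_q a i \<in> cf_range B"
proof -
  define r where "r i = real_of_int (conv_q a (Suc i)) / conv_q a i" for i
  have B: "B \<ge> 1" using assms[of 1] by (auto intro: order_trans[of _ "real_of_int (a 1)"])
  have rec: "r (Suc i) = a (Suc (Suc i)) + 1 / r i" for i
    unfolding r_def by (rule conv_q_ratio_Suc) (use assms in blast)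
  have *: "1 \<le> r i \<and> r i \<le> B + 1 \<and> (i > 0 \<longrightarrow> r i \<in> cf_range B)" for i
  proof (induction i)
    case 0
    then show ?case using assms[of 1] by (auto simp: r_def)
  next
    case (Suc i)
    then have "r (Suc i) \<in> cf_range B"
      unfolding rec using assms[of "Suc (Suc i)"] by (intro cf_step_in_range) auto
    then show ?case using cf_range_ge_1[OF _ B] cf_range_le by auto
  qed
  show "1 \<le> real_of_int (conv_q a (Suc i)) / conv_q a i"
    "i > 0 \<Longrightarrow> real_of_int (conv_q a (Suc i)) / conv_q a i \<in> cf_range B"
    using *[of i] by (simp_all add: r_def)
qed

text \<open>Unrolling the recurrence peels off partial quotients from index \<open>i + 1\<close>
  downwards; this is where reversed words come from.\<close>

lemma conv_q_ratio_cf_tail: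
  assumes "\<And>i. i \<ge> 1 \<Longrightarrow> a i \<ge> 1" "n \<le> i"
  shows "real_of_int (conv_q a (Suc i)) / conv_q a i =
    cf_tail (\<lambda>s. a (Suc i - s)) n (real_of_int (conv_q a (Suc (i - n))) / conv_q a (i - n))"
  using assms(2)
proof (induction n)
  case (Suc n)
  then obtain m where m: "i - n = Suc m" "i - Suc n = m" "Suc i - n = Suc (Suc m)"
    by (metis Suc_diff_Suc Suc_diff_le Suc_le_eq less_imp_le)
  show ?case using Suc conv_q_ratio_Suc[of a m, OF assms(1)] by (simp add: m)
qed simp

text \<open>Late positions matching \<open>b\<close> on \<open>n\<close> letters have ratios within
  \<open>cf_rate B ^ n * B\<close> of \<open>L\<close>, and there are infinitely many. At other late
  positions the first mismatch has larger key, so the ratio falls below \<open>L\<close> in the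
  order given by \<sigma> by at most that error.\<close>

lemma conv_q_ratio_alt_least_rev:
  fixes B :: real
  assumes a: "\<And>i. i \<ge> 1 \<Longrightarrow> a i \<ge> 1 \<and> a i \<le> B"
    and b: "alt_least_rev \<sigma> a b" and \<sigma>: "\<sigma> = 1 \<or> \<sigma> = -1"
  defines "r \<equiv> \<lambda>i. real_of_int (conv_q a (Suc i)) / conv_q a i"
  shows "\<exists>L. cf_expansion b L \<and>
    (\<forall>\<epsilon>>0. \<forall>\<^sub>F i in sequentially. \<sigma> * L - \<epsilon> \<le> \<sigma> * r i) \<and>
    (\<forall>\<epsilon>>0. \<exists>\<^sub>F i in sequentially. \<sigma> * r i \<le> \<sigma> * L + \<epsilon>)"
proof -
  have B: "B \<ge> 1" using a[of 1] by (auto intro: order_trans[of _ "real_of_int (a 1)"])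
  have a1: "\<And>i. i \<ge> 1 \<Longrightarrow> a i \<ge> 1" using a by blast
  have bB: "1 \<le> b s \<and> b s \<le> B" for s using alt_least_rev_mem[OF b, of 1 s] a by auto
  obtain L where L: "cf_expansion b L"
    "\<And>n z. z \<in> cf_range B \<Longrightarrow> \<bar>cf_tail b n z - L\<bar> \<le> cf_rate B ^ n * B"
    using cf_tail_limit[of B b] B bB by blast
  have match: "r i = cf_tail b n (r (i - n))" if "n \<le> i" "rev_match a (Suc i) b n" for i n
  proof -
    have "cf_tail (\<lambda>s. a (Suc i - s)) n (r (i - n)) = cf_tail b n (r (i - n))"
      using that(2) by (intro cf_tail_cong) (simp add: rev_match_def)
    then show ?thesis using conv_q_ratio_cf_tail[of a n i, OF a1 that(1)] by (simp add: r_def)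
  qed
  have close: "\<bar>r i - L\<bar> \<le> cf_rate B ^ n * B" if "n < i" "rev_match a (Suc i) b n" for i n
    using match[of n i] that L(2)[of "r (i - n)" n] conv_q_ratio_bounds(2)[of a B "i - n", OF a]
    by (simp add: r_def)
  have low: "\<sigma> * L - cf_rate B ^ n * B \<le> \<sigma> * r i"
    if i: "Suc n < i" and n: "\<not> rev_match a (Suc i) b n" and min: "\<And>t. t \<le> n \<Longrightarrow> rev_match a (Suc i) b t \<Longrightarrow>
       \<not> alt_key \<sigma> t (a (Suc i - t)) < alt_key \<sigma> t (b t)" for i n
  proof -
    obtain m where m: "n = Suc m" using n by (cases n) (auto simp: rev_match_def)
    obtain t where t: "t \<le> m" "rev_match a (Suc i) b t" "a (Suc i - t) \<noteq> b t"
      using rev_match_mismatchE n unfolding m by blast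
    let ?d = "a (Suc i - t)"
    have less: "alt_key \<sigma> t (b t) < alt_key \<sigma> t ?d"
      using min[of t] t m alt_key_inj[of \<sigma> t ?d "b t"] \<sigma> by force
    \<comment> \<open>An approximation of \<open>L\<close> by \<open>n\<close> letters of
      \<open>b\<close> is rewritten as a tail after \<open>t + 1\<close> letters, to be compared at
      the mismatch \<open>t\<close>.\<close>
    obtain w where w: "w \<in> cf_range B" "cf_tail b n (B + 1) = cf_tail b (Suc t) w"
      using cf_tail_prefix[of B n b "B + 1" "Suc t"] B bB cf_range_top[OF B] t(1) m by auto
    then have near: "\<bar>cf_tail b (Suc t) w - L\<bar> \<le> cf_rate B ^ n * B"
      using L(2)[OF cf_range_top[OF B], of n] by simp
    \<comment> \<open>One more unrolling is possible and exposes the mismatching letter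
      \<open>?d\<close>.\<close>
    obtain j where j: "i - t = Suc j" using i t(1) m by (metis Suc_diff_Suc Suc_lessD le_less_trans less_Suc_eq_le)
    then have j': "Suc i - t = Suc (Suc j)" by linarith
    have "r i = cf_tail b t (r (Suc j))" using match[of t i] t i m j by simp
    also have "r (Suc j) = ?d + 1 / r j"
      unfolding r_def j' by (rule conv_q_ratio_Suc[OF a1])
    finally have "r i = cf_tail b t (?d + 1 / r j)" .
    moreover have "\<sigma> * cf_tail b t (b t + 1 / w) \<le> \<sigma> * cf_tail b t (?d + 1 / r j)"
    proof (rule cf_tail_alt_less)
      show "1 \<le> ?d" using a1 j' by simp
      show "1 \<le> w" using cf_range_ge_1[OF w(1) B] .
      show "1 \<le> r j" unfolding r_def by (rule conv_q_ratio_bounds(1)[OF a])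
    qed (use bB \<sigma> less in auto)
    ultimately have "\<sigma> * cf_tail b (Suc t) w \<le> \<sigma> * r i" by simp
    then show ?thesis using near \<sigma> by auto
  qed
  have rate: "\<exists>n. cf_rate B ^ n * B < \<epsilon>" if "\<epsilon> > 0" for \<epsilon>
  proof -
    have "(\<lambda>n. cf_rate B ^ n * B) \<longlonglongrightarrow> 0"
      using cf_rate_bounds[OF B] by (intro tendsto_mult_left_zero LIMSEQ_power_zero) auto
    then have "\<forall>\<^sub>F n in sequentially. cf_rate B ^ n * B < \<epsilon>"
      using that by (intro order_tendstoD(2)) auto
    then show ?thesis by (auto simp: eventually_sequentially)
  qed
  show ?thesis
  proof (rule exI[of _ L], intro conjI allI impI L(1))
    fix \<epsilon> :: real assume "\<epsilon> > 0"
    then obtain n where n: "cf_rate B ^ n * B < \<epsilon>" using rate by blast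
    have "\<forall>\<^sub>\<infinity>i. \<forall>t\<in>{..n}. rev_match a i b t \<longrightarrow> \<not> alt_key \<sigma> t (a (i - t)) < alt_key \<sigma> t (b t)"
      using b unfolding alt_least_rev_def by (intro eventually_ball_finite) auto
    then obtain M where M: "\<And>i t. \<lbrakk>M \<le> i; t \<le> n; rev_match a i b t\<rbrakk> \<Longrightarrow>
        \<not> alt_key \<sigma> t (a (i - t)) < alt_key \<sigma> t (b t)"
      unfolding MOST_nat_le by auto
    have "\<sigma> * L - \<epsilon> \<le> \<sigma> * r i" if i: "i > M + Suc n" for i
    proof (cases "rev_match a (Suc i) b n")
      case True
      then show ?thesis using close[of n i] i n \<sigma> by auto
    next
      case False
      have "\<sigma> * L - cf_rate B ^ n * B \<le> \<sigma> * r i"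
        using i by (intro low[OF _ False] M) auto
      then show ?thesis using n by linarith
    qed
    then show "\<forall>\<^sub>F i in sequentially. \<sigma> * L - \<epsilon> \<le> \<sigma> * r i"
      unfolding eventually_sequentially by (intro exI[of _ "Suc (M + Suc n)"]) auto
  next
    fix \<epsilon> :: real assume "\<epsilon> > 0"
    then obtain n where n: "cf_rate B ^ n * B < \<epsilon>" using rate by blast
    show "\<exists>\<^sub>F i in sequentially. \<sigma> * r i \<le> \<sigma> * L + \<epsilon>"
      unfolding frequently_sequentially
    proof
      fix N
      obtain j where j: "j \<ge> Suc (Suc (N + n))" "rev_match a j b n"
        using b unfolding alt_least_rev_def INFM_nat_le by blast
      then obtain i where i: "j = Suc i" "i \<ge> Suc (N + n)" by (cases j) auto
      then have "\<bar>r i - L\<bar> \<le> cf_rate B ^ n * B" using close[of n i] j by simp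
      then show "\<exists>i\<ge>N. \<sigma> * r i \<le> \<sigma> * L + \<epsilon>" using i n \<sigma> by (intro exI[of _ i]) auto
    qed
  qed
qed

section \<open>Limits inferior and the comparison of numerator and denominator ratios\<close>

lemma liminf_ereal_eqI:
  fixes R :: "nat \<Rightarrow> real"
  assumes "\<And>\<epsilon>. \<epsilon> > 0 \<Longrightarrow> \<forall>\<^sub>F i in sequentially. L - \<epsilon> \<le> R i"
    and "\<And>\<epsilon>. \<epsilon> > 0 \<Longrightarrow> \<exists>\<^sub>F i in sequentially. R i \<le> L + \<epsilon>"
  shows "liminf (\<lambda>i. ereal (R i)) = ereal L"
proof (rule antisym)
  show "ereal L \<le> liminf (\<lambda>i. ereal (R i))"
    unfolding le_Liminf_iff
  proof (intro allI impI)
    fix y assume y: "y < ereal L"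
    show "\<forall>\<^sub>F i in sequentially. y < ereal (R i)"
    proof (cases y)
      case (real z)
      then have "z < L" using y by simp
      then show ?thesis using assms(1)[of "(L - z) / 2"] unfolding real
        by (auto elim!: eventually_mono simp: field_simps)
    qed (use y in auto)
  qed
  show "liminf (\<lambda>i. ereal (R i)) \<le> ereal L"
  proof (rule ccontr)
    assume "\<not> ?thesis"
    then have "ereal L < liminf (\<lambda>i. ereal (R i))" by simp
    from ereal_dense2[OF this] obtain y where y: "L < y" "ereal y < liminf (\<lambda>i. ereal (R i))"
      by auto
    have "\<forall>\<^sub>F i in sequentially. ereal y < ereal (R i)" using y(2) by (rule less_LiminfD)
    moreover have "\<exists>\<^sub>F i in sequentially. R i \<le> L + (y - L)" using y(1) by (intro assms(2)) simp
    ultimately show False by (simp add: frequently_def not_le)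
  qed
qed

lemma liminf_ereal_perturb_eqI:
  fixes R r :: "nat \<Rightarrow> real"
  assumes "\<And>\<epsilon>. \<epsilon> > 0 \<Longrightarrow> \<forall>\<^sub>F i in sequentially. L - \<epsilon> \<le> r i"
    and "\<And>\<epsilon>. \<epsilon> > 0 \<Longrightarrow> \<exists>\<^sub>F i in sequentially. r i \<le> L + \<epsilon>"
    and "(\<lambda>i. R i - r i) \<longlonglongrightarrow> 0"
  shows "liminf (\<lambda>i. ereal (R i)) = ereal L"
proof (rule liminf_ereal_eqI)
  fix \<epsilon> :: real assume "\<epsilon> > 0"
  then have e: "\<epsilon> / 2 > 0" by simp
  have close: "\<forall>\<^sub>F i in sequentially. \<bar>R i - r i\<bar> < \<epsilon> / 2"
    using tendstoD[OF assms(3) e] by (simp add: dist_real_def)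
  show "\<forall>\<^sub>F i in sequentially. L - \<epsilon> \<le> R i"
    using close assms(1)[OF e] by eventually_elim linarith
  have "\<forall>\<^sub>F i in sequentially. r i \<le> L + \<epsilon> / 2 \<longrightarrow> R i \<le> L + \<epsilon>"
    using close by eventually_elim linarith
  then show "\<exists>\<^sub>F i in sequentially. R i \<le> L + \<epsilon>"
    by (rule frequently_mp) (rule assms(2)[OF e])
qed

lemma conv_det:
  "conv_p a (Suc n) * conv_q a n - conv_p a n * conv_q a (Suc n) = (-1) ^ n"
  by (induction n) (auto simp: algebra_simps)

text \<open>By the determinant identity the difference is, up to sign,
  \<open>1 / (p\<^sub>n q\<^sub>n)\<close>. Some numerators may vanish, but not eventually, because
  \<alpha> is nonzero; then the numerator has absolute value at least 1 and the denominator is at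
  least \<open>n\<close>.\<close>

lemma conv_ratio_diff_tendsto_0:
  assumes a: "cf_expansion a \<alpha>" and \<alpha>: "\<alpha> \<noteq> 0"
  shows "(\<lambda>n. real_of_int (conv_p a (Suc n)) / conv_p a n
    - real_of_int (conv_q a (Suc n)) / conv_q a n) \<longlonglongrightarrow> 0"
proof (rule tendsto_0_le[where K = 1])
  have a1: "\<And>i. i \<ge> 1 \<Longrightarrow> a i \<ge> 1" using a by (simp add: cf_expansion_def)
  show "(\<lambda>n. 1 / real n) \<longlonglongrightarrow> 0" by (rule lim_1_over_n)
  have "\<forall>\<^sub>F n in sequentially. real_of_int (conv_p a n) / conv_q a n \<noteq> 0"
    using a \<alpha> unfolding cf_expansion_def by (intro tendsto_imp_eventually_ne) auto
  then show "\<forall>\<^sub>F n in sequentially. norm (real_of_int (conv_p a (Suc n)) / conv_p a n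
    - real_of_int (conv_q a (Suc n)) / conv_q a n) \<le> norm (1 / real n) * 1"
    using eventually_gt_at_top[of 0]
  proof eventually_elim
    case (elim n)
    have p: "conv_p a n \<noteq> 0" using elim by auto
    have q: "conv_q a n \<ge> 1" "conv_q a n \<ge> int n" using conv_q_ge_1 conv_q_ge a1 by blast+
    have det: "real_of_int (conv_p a (Suc n)) * conv_q a n - real_of_int (conv_q a (Suc n)) * conv_p a n
      = (-1) ^ n"
      using conv_det[of a n, THEN arg_cong[of _ _ real_of_int]] by (simp add: mult.commute)
    have "real_of_int (conv_p a (Suc n)) / conv_p a n - real_of_int (conv_q a (Suc n)) / conv_q a n
      = (-1) ^ n / (real_of_int (conv_p a n) * conv_q a n)"
      unfolding det[symmetric] using p q(1) by (simp add: diff_frac_eq)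
    then have "norm (real_of_int (conv_p a (Suc n)) / conv_p a n
        - real_of_int (conv_q a (Suc n)) / conv_q a n)
      = 1 / (\<bar>real_of_int (conv_p a n)\<bar> * conv_q a n)"
      using q(1) by (simp add: abs_mult power_abs)
    also have "\<dots> \<le> 1 / real n"
    proof (rule divide_left_mono)
      have "1 * real n \<le> \<bar>real_of_int (conv_p a n)\<bar> * conv_q a n"
        using p q by (intro mult_mono) (linarith | simp)+
      then show "real n \<le> \<bar>real_of_int (conv_p a n)\<bar> * conv_q a n" by simp
      show "0 < \<bar>real_of_int (conv_p a n)\<bar> * real_of_int (conv_q a n) * real n"
        using p q elim by (intro mult_pos_pos) auto
    qed simp
    finally show ?case by simp
  qed
qed

theorem theorem9:
  fixes k :: nat and \<alpha> :: real and a :: "nat \<Rightarrow> int"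
  assumes "k \<ge> 2"
    and "\<alpha> \<notin> \<rat>"
    and "cf_expansion a \<alpha>"
    and "automatic_cf k a"
  shows "\<exists>\<beta> \<gamma> \<delta> \<zeta> :: real.
      liminf (\<lambda>n. ereal (real_of_int (conv_p a (Suc n)) / real_of_int (conv_p a n))) = ereal \<beta> \<and>
      liminf (\<lambda>n. ereal (real_of_int (conv_q a (Suc n)) / real_of_int (conv_q a n))) = ereal \<gamma> \<and>
      limsup (\<lambda>n. ereal (real_of_int (conv_p a (Suc n)) / real_of_int (conv_p a n))) = ereal \<delta> \<and>
      limsup (\<lambda>n. ereal (real_of_int (conv_q a (Suc n)) / real_of_int (conv_q a n))) = ereal \<zeta> \<and>
      has_automatic_cf k \<beta> \<and> has_automatic_cf k \<gamma> \<and>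
      has_automatic_cf k \<delta> \<and> has_automatic_cf k \<zeta>"
proof -
  let ?p = "\<lambda>n. real_of_int (conv_p a (Suc n)) / real_of_int (conv_p a n)"
  let ?q = "\<lambda>n. real_of_int (conv_q a (Suc n)) / real_of_int (conv_q a n)"
  obtain B where B: "\<And>i. \<bar>a i\<bar> \<le> B" and aut: "automatic_seq k a"
    using assms(4) unfolding automatic_cf_def by blast
  have "range a \<subseteq> {- B..B}" using B by (auto simp: abs_le_iff minus_le_iff)
  then have fin: "finite (range a)" by (rule finite_subset) simp
  have aB: "a i \<ge> 1 \<and> a i \<le> real_of_int B" if "i \<ge> 1" for i
    using assms(3) that B[of i] by (auto simp: cf_expansion_def abs_le_iff)
  have "\<alpha> \<noteq> 0" using assms(2) by auto
  from conv_ratio_diff_tendsto_0[OF assms(3) this]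
  have diff: "(\<lambda>n. ?p n - ?q n) \<longlonglongrightarrow> 0" .
  \<comment> \<open>The sign \<sigma> covers limits inferior and superior, and the arbitrary
    \<open>R\<close> covers both ratios with the same \<open>L\<close>.\<close>
  have main: "\<exists>L :: real. has_automatic_cf k L \<and>
      (\<forall>R :: nat \<Rightarrow> real. (\<lambda>n. R n - ?q n) \<longlonglongrightarrow> 0 \<longrightarrow> liminf (\<lambda>n. ereal (\<sigma> * R n)) = ereal (\<sigma> * L))"
    if \<sigma>: "\<sigma> = 1 \<or> \<sigma> = -1" for \<sigma> :: int
  proof -
    obtain b where b: "alt_least_rev \<sigma> a b" using alt_least_rev_exists[OF fin] by blast
    obtain L :: real where L: "cf_expansion b L"
      "\<And>\<epsilon> :: real. \<epsilon> > 0 \<Longrightarrow> \<forall>\<^sub>F i in sequentially. \<sigma> * L - \<epsilon> \<le> \<sigma> * ?q i"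
      "\<And>\<epsilon> :: real. \<epsilon> > 0 \<Longrightarrow> \<exists>\<^sub>F i in sequentially. \<sigma> * ?q i \<le> \<sigma> * L + \<epsilon>"
      using conv_q_ratio_alt_least_rev[of a B \<sigma> b] aB b \<sigma> by blast
    have "\<bar>b i\<bar> \<le> B" for i using alt_least_rev_mem[OF b, of 0 i] B by auto
    moreover have "automatic_seq k b"
      using automatic_seq_alt_least_rev[OF assms(1) aut fin b] \<sigma> by auto
    ultimately have "has_automatic_cf k L"
      unfolding has_automatic_cf_def automatic_cf_def using L(1) by blast
    moreover have "liminf (\<lambda>n. ereal (\<sigma> * R n)) = ereal (\<sigma> * L)"
      if R: "(\<lambda>n. R n - ?q n) \<longlonglongrightarrow> 0" for R :: "nat \<Rightarrow> real"
    proof (rule liminf_ereal_perturb_eqI[OF L(2,3)])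
      have "(\<lambda>n. \<sigma> * (R n - ?q n)) \<longlonglongrightarrow> 0" by (rule tendsto_mult_right_zero[OF R])
      then show "(\<lambda>n. \<sigma> * R n - \<sigma> * ?q n) \<longlonglongrightarrow> 0" by (simp only: right_diff_distrib)
    qed
    ultimately show ?thesis by blast
  qed
  obtain \<beta> where \<beta>: "has_automatic_cf k \<beta>"
    "\<And>R. (\<lambda>n. R n - ?q n) \<longlonglongrightarrow> 0 \<Longrightarrow> liminf (\<lambda>n. ereal (R n)) = ereal \<beta>"
    using main[of 1] by auto
  obtain \<delta> where \<delta>: "has_automatic_cf k \<delta>"
    "\<And>R. (\<lambda>n. R n - ?q n) \<longlonglongrightarrow> 0 \<Longrightarrow> liminf (\<lambda>n. ereal (- R n)) = ereal (- \<delta>)"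
    using main[of "-1"] by auto
  \<comment> \<open>The limit superior is the negated limit inferior of the negated
    sequence.\<close>
  have sup: "limsup (\<lambda>n. ereal (R n)) = ereal \<delta>" if "(\<lambda>n. R n - ?q n) \<longlonglongrightarrow> 0" for R
    using ereal_Limsup_uminus[of sequentially "\<lambda>n. ereal (- R n)"] \<delta>(2)[OF that] by simp
  have triv: "(\<lambda>n. ?q n - ?q n) \<longlonglongrightarrow> 0" by simp
  show ?thesis
    using \<beta>(2)[OF diff] \<beta>(2)[OF triv] sup[OF diff] sup[OF triv] \<beta>(1) \<delta>(1)
    by (intro exI conjI)
qed

end
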